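(* Let $\{x^k\}_{k\ge 0}$ be an infinite sequence generated by the regularized proximal Newton method (described in the context) for minimizing $F=f+\varphi$, with $r(x^k)\neq 0$ for all $k$. Then $\liminf_{k\to\infty}\|r(x^k)\|=0$.
   Context: Setting. Let $A\in\mathbb{R}^{m\times n}$, $b\in\mathbb{R}^m$, and let $\psi:\mathbb{R}^m\to\mathbb{R}\cup\{\infty\}$, $\varphi:\mathbb{R}^n\to\mathbb{R}\cup\{\infty\}$ be proper lower semicontinuous. Put $f(x)=\psi(Ax-b)$, $F=f+\varphi$. Standing assumptions: (i) there is a closed set $\Omega\subseteq\mathbb{R}^n$ with $\operatorname{dom}\varphi\subseteq\Omega$ such that $\psi$ is twice continuously differentiable on an open set containing $\{Ax-b: x\in\Omega\}$; (ii) $\varphi$ is convex and continuous on (relative to) $\operatorname{dom}\varphi$; (iii) $\inf F>-\infty$. Thus $\nabla f(x)=A^\top\nabla\psi(Ax-b)$, $\nabla^2f(x)=A^\top\nabla^2\psi(Ax-b)A$ for $x\in\Omega$. $\|\cdot\|$ is the Euclidean norm for vectors and the spectral norm for matrices, $\lambda_{\min}$ is the smallest eigenvalue, $t_+=\max(0,t)$, $\operatorname{prox}_\varphi(x)=\operatorname{argmin}_y\{\varphi(y)+\frac12\|y-x\|^2\}$. The residual is $r(x)=x-\operatorname{prox}_\varphi(x-\nabla f(x))$; $x\in\operatorname{dom}\varphi$ is stationary, i.e. $0\in\nabla f(x)+\partial\varphi(x)$, iff $r(x)=0$. Algorithm (regularized proximal Newton method). Choose $x^0\in\operatorname{dom}\varphi$,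 $0<c_1<c_2<1$, $\sigma_1\in(0,1)$, $\sigma_2>1$, $\eta,\theta,\alpha\in(0,1)$, $a\ge1$, $0<\nu_{\min}\le\nu_0\le\overline\nu$, $0<\delta\le1$, $\tau\ge\delta$, $p_{\min}\in(0,1/2)$, $\kappa>1+\delta$. Set $\overline r_0=\|r(x^0)\|$, $\mu_0=\nu_0\overline r_0^{\,\delta}$. For $k=0,1,2,\dots$: Let $\Lambda_k=a[-\lambda_{\min}(\nabla^2\psi(Ax^k-b))]_+$, $H_k=\nabla^2f(x^k)+\Lambda_kA^\top A$ (positive semidefinite), $G_k=H_k+\mu_kI$, $q_k(x)=f(x^k)+\nabla f(x^k)^\top(x-x^k)+\frac12(x-x^k)^\top\nabla^2f(x^k)(x-x^k)+\varphi(x)$, $\hat q_k(x)=f(x^k)+\nabla f(x^k)^\top(x-x^k)+\frac12(x-x^k)^\top G_k(x-x^k)+\varphi(x)$, $R_k(x)=x-\operatorname{prox}_\varphi(x-\nabla f(x^k)-G_k(x-x^k))$. Step 1: compute an inexact minimizer $\hat x^k$ of $\hat q_k$, i.e. any point with $\|R_k(\hat x^k)\|\le\theta\min\{\|r(x^k)\|,\|r(x^k)\|^{1+\tau}\}$ and $F(x^k)-\hat q_k(\hat x^k)\ge\frac{\alpha\mu_k}{2}\|\hat x^k-x^k\|^2$. Step 2: set $d^k=\hat x^k-x^k$, $\mathrm{pred}_k=F(x^k)-q_k(\hat x^k)$, $\mathrm{ared}_k=F(x^k)-F(\hat x^k)$, $\rho_k=\mathrm{ared}_k/\mathrm{pred}_k$.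 Step 3: if $\mathrm{pred}_k\le p_{\min}(1-\theta)\|d^k\|\min\{\|r(x^k)\|,\|r(x^k)\|^\kappa\}$ or $\rho_k\le c_1$, set $x^{k+1}=x^k$, $\nu_{k+1}=\sigma_2\nu_k$ (unsuccessful iteration). Otherwise set $x^{k+1}=\hat x^k$ and: if $\rho_k\le c_2$, $\nu_{k+1}=\min\{\nu_k,\overline\nu\}$ (successful iteration); if $\rho_k>c_2$, $\nu_{k+1}=\min\{\max\{\sigma_1\nu_k,\nu_{\min}\},\overline\nu\}$ (highly successful iteration). Step 4: if $\|r(x^{k+1})\|\le\eta\overline r_k$, set $\overline r_{k+1}=\|r(x^{k+1})\|$; otherwise $\overline r_{k+1}=\overline r_k$. Set $\mu_{k+1}=\nu_{k+1}\overline r_{k+1}^{\,\delta}$. *)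

theory Defs
  imports "HOL-Analysis.Analysis"
begin

definition edom :: "('a \<Rightarrow> ereal) \<Rightarrow> 'a set" where
  "edom g = {x. g x < \<infinity>}"

definition proper_fun :: "('a \<Rightarrow> ereal) \<Rightarrow> bool" where
  "proper_fun g \<longleftrightarrow> (\<forall>x. g x \<noteq> -\<infinity>) \<and> edom g \<noteq> {}"

definition lsc_fun :: "('a::topological_space \<Rightarrow> ereal) \<Rightarrow> bool" where
  "lsc_fun g \<longleftrightarrow> (\<forall>x. g x \<le> Liminf (at x) g)"

text \<open>In \<^typ>\<open>ereal\<close> one has \<^prop>\<open>0 * \<infinity> = (0::ereal)\<close>, so the inequality is harmless for
  weights \<open>0\<close> and \<open>1\<close>.\<close>

definition convex_fun :: "('a::real_vector \<Rightarrow> ereal) \<Rightarrow> bool" where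
  "convex_fun g \<longleftrightarrow> (\<forall>x y u v. 0 \<le> u \<longrightarrow> 0 \<le> v \<longrightarrow> u + v = 1 \<longrightarrow>
     g (u *\<^sub>R x + v *\<^sub>R y) \<le> ereal u * g x + ereal v * g y)"

text \<open>The derivatives of an extended-real-valued function are those of its real part; they are
  meaningful only at interior points of the region where the function is finite.\<close>

definition gradient :: "('a::real_inner \<Rightarrow> ereal) \<Rightarrow> 'a \<Rightarrow> 'a" where
  "gradient g x = (THE D. gderiv (\<lambda>y. real_of_ereal (g y)) x D)"

definition hessian :: "(real^'n \<Rightarrow> ereal) \<Rightarrow> real^'n \<Rightarrow> real^'n^'n" where
  "hessian g x = jacobian (gradient g) (at x)"

definition twice_cont_diff_on :: "(real^'n) set \<Rightarrow> (real^'n \<Rightarrow> ereal) \<Rightarrow> bool" where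
  "twice_cont_diff_on U g \<longleftrightarrow>
     (\<forall>y\<in>U. \<bar>g y\<bar> \<noteq> \<infinity>) \<and>
     (\<forall>y\<in>U. (\<lambda>z. real_of_ereal (g z)) differentiable (at y)) \<and>
     (\<forall>y\<in>U. gradient g differentiable (at y)) \<and>
     continuous_on U (hessian g)"

text \<open>Intended for symmetric matrices, where real eigenvalues exist.\<close>

definition lambda_min :: "real^'n^'n \<Rightarrow> real" where
  "lambda_min M = (LEAST l. \<exists>v. v \<noteq> 0 \<and> M *v v = l *\<^sub>R v)"

definition prox :: "('a::real_normed_vector \<Rightarrow> ereal) \<Rightarrow> 'a \<Rightarrow> 'a" where
  "prox \<phi> x = arg_min (\<lambda>y. \<phi> y + ereal (1/2 * (norm (y - x))\<^sup>2)) (\<lambda>_. True)"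

definition residual :: "('a::real_inner \<Rightarrow> ereal) \<Rightarrow> ('a \<Rightarrow> ereal) \<Rightarrow> 'a \<Rightarrow> 'a" where
  "residual f \<phi> x = x - prox \<phi> (x - gradient f x)"

end

theory Submission
  imports Defs
begin

text \<open>
  If the residuals stay above some \<open>\<epsilon> > 0\<close>, the reduction test bounds \<open>\<parallel>x\<^sub>k\<^sub>+\<^sub>1 - x\<^sub>k\<parallel>\<close> by a constant
  times \<open>F(x\<^sub>k) - F(x\<^sub>k\<^sub>+\<^sub>1)\<close>, so the iterates converge to a point of \<open>\<Omega>\<close>, near which the derivatives of
  \<open>f\<close> are bounded. There a large \<open>\<mu>\<^sub>k\<close> forces a short step, on which predicted and actual reduction
  differ only by \<open>O(\<parallel>d\<^sub>k\<parallel>\<^sup>2)\<close> while the prediction is at least \<open>(1 + \<alpha>) \<mu>\<^sub>k / 2\<close> times \<open>\<parallel>d\<^sub>k\<parallel>\<^sup>2\<close>; so the step is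
  accepted. Hence \<open>\<nu>\<^sub>k\<close> stays bounded and steps are accepted infinitely often. By nonexpansiveness of
  the proximal map the step length is at least a constant times \<open>\<epsilon>\<close>, so infinitely many
  accepted steps make \<open>F\<close> decrease without bound, a contradiction.
\<close>

section \<open>Proximal points\<close>

text \<open>\<open>Liminf (at l)\<close> ignores the value at \<open>l\<close> itself; the second
  hypothesis supplies that point, so the bound holds on a full neighbourhood.\<close>

lemma lsc_fun_eventually_gt:
  assumes "lsc_fun g" "c < g l"
  shows "eventually (\<lambda>y. c < g y) (nhds l)"
proof -
  have "c < Liminf (at l) g"
    using assms unfolding lsc_fun_def by (meson less_le_trans)
  then have "eventually (\<lambda>y. c < g y) (at l)"
    by (rule less_LiminfD)
  then show ?thesis
    using assms(2) by (auto simp: eventually_at_filter elim: eventually_mono)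
qed

lemma lsc_funI:
  assumes "\<And>l c. c < g l \<Longrightarrow> eventually (\<lambda>y. c < g y) (nhds l)"
  shows "lsc_fun g"
  unfolding lsc_fun_def
proof (intro allI)
  fix l
  show "g l \<le> Liminf (at l) g"
    unfolding le_Liminf_iff eventually_at_filter
    using assms by (blast intro: eventually_mono)
qed

lemma lsc_fun_add_continuous:
  assumes g: "lsc_fun g" and h: "continuous_on UNIV h"
  shows "lsc_fun (\<lambda>y. g y + ereal (h y))"
proof (rule lsc_funI)
  fix l and c :: ereal
  assume "c < g l + ereal (h l)"
  then have "c - ereal (h l) < g l"
    by (cases c; cases "g l") auto
  \<comment> \<open>The slack is split at \<open>t\<close>: near \<open>l\<close>, \<open>g\<close>
    exceeds \<open>t\<close> and \<open>h\<close> exceeds \<open>c - t\<close>.\<close>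
  then obtain t where t: "c - ereal (h l) < ereal t" "ereal t < g l"
    using ereal_dense2 by blast
  have "eventually (\<lambda>y. ereal t < g y) (nhds l)"
    using lsc_fun_eventually_gt[OF g t(2)] .
  moreover have "eventually (\<lambda>y. c < ereal (t + h y)) (nhds l)"
  proof (cases c)
    case (real c')
    have "(h \<longlongrightarrow> h l) (nhds l)"
      using h by (metis UNIV_I continuous_on_def tendsto_at_iff_tendsto_nhds)
    moreover have "c' - t < h l" using t(1) real by auto
    ultimately have "eventually (\<lambda>y. c' - t < h y) (nhds l)"
      by (rule order_tendstoD)
    then show ?thesis using real by (auto elim: eventually_mono)
  qed (use t(1) in auto)
  ultimately show "eventually (\<lambda>y. c < g y + ereal (h y)) (nhds l)"
  proof eventually_elim
    case (elim y)
    then show ?case by (cases "g y") (auto intro: less_trans)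
  qed
qed

text \<open>A minimizing sequence in \<open>K\<close> has a convergent subsequence, and lower
  semicontinuity forbids a jump upwards at its limit. Values may be infinite.\<close>

lemma lsc_fun_attains_inf:
  fixes g :: "'a::metric_space \<Rightarrow> ereal"
  assumes "compact K" "K \<noteq> {}" "lsc_fun g"
  shows "\<exists>p\<in>K. \<forall>y\<in>K. g p \<le> g y"
proof -
  obtain u where u: "\<And>n. u n \<in> g ` K" "u \<longlonglongrightarrow> Inf (g ` K)"
    using Inf_as_limit[of "g ` K"] assms(2) by blast
  then have "\<forall>n. \<exists>w. w \<in> K \<and> u n = g w" by blast
  then obtain v where v: "\<And>n. v n \<in> K" "\<And>n. u n = g (v n)"
    by metis
  obtain p s where p: "p \<in> K" "strict_mono s" "(v \<circ> s) \<longlonglongrightarrow> p"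
    using assms(1) v(1) unfolding compact_def by metis
  have "g p \<le> Inf (g ` K)"
  proof (rule ccontr)
    assume "\<not> g p \<le> Inf (g ` K)"
    then obtain c where c: "Inf (g ` K) < c" "c < g p"
      by (meson dense not_le)
    have "eventually (\<lambda>n. c < g ((v \<circ> s) n)) sequentially"
      using lsc_fun_eventually_gt[OF assms(3) c(2)] p(3) unfolding filterlim_iff by blast
    moreover have "eventually (\<lambda>n. (u \<circ> s) n < c) sequentially"
      using order_tendstoD(2)[OF LIMSEQ_subseq_LIMSEQ[OF u(2) p(2)] c(1)] .
    ultimately have "eventually (\<lambda>n::nat. False) sequentially"
      by eventually_elim (simp add: v(2))
    then show False by simp
  qed
  then show ?thesis using p(1) by (meson INF_lower order_trans)
qed

lemma edom_real:
  assumes "proper_fun g" "y \<in> edom g"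
  shows "g y = ereal (real_of_ereal (g y))"
  using assms by (cases "g y") (auto simp: proper_fun_def edom_def)

text \<open>On the unit ball around \<open>x0\<close> lower semicontinuity gives a bound; convexity along the
  segment from \<open>x0\<close> to \<open>y\<close> transports it to all \<open>y\<close>, with linear loss.\<close>

lemma convex_lsc_linear_minorant:
  fixes g :: "'a::euclidean_space \<Rightarrow> ereal"
  assumes g: "proper_fun g" "lsc_fun g" "convex_fun g" and x0: "x0 \<in> edom g"
  obtains C where "C \<ge> 0" "\<And>y. ereal (- C * (1 + norm (y - x0))) \<le> g y"
proof -
  obtain p where p: "p \<in> cball x0 1" "\<And>y. y \<in> cball x0 1 \<Longrightarrow> g p \<le> g y"
    using lsc_fun_attains_inf[of "cball x0 1" g] g(2) by auto
  have "g p \<le> g x0" by (rule p(2)) simp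
  then have "p \<in> edom g" using x0 by (auto simp: edom_def)
  then obtain m where m: "g p = ereal m" using edom_real[OF g(1)] by blast
  obtain a where a: "g x0 = ereal a" using edom_real[OF g(1) x0] by blast
  define C where "C = \<bar>m\<bar> + \<bar>a\<bar>"
  have "ereal (- C * (1 + norm (y - x0))) \<le> g y" for y
  proof (cases "y \<in> cball x0 1")
    case True
    then have "ereal m \<le> g y" using p(2) m by auto
    have "C * 1 \<le> C * (1 + norm (y - x0))"
      by (intro mult_left_mono) (auto simp: C_def)
    moreover have "- C \<le> m" by (simp add: C_def)
    ultimately have "- C * (1 + norm (y - x0)) \<le> m"
      unfolding mult_minus_left by linarith
    then show ?thesis using \<open>ereal m \<le> g y\<close> by (meson ereal_less_eq(3) order_trans)
  next
    case False
    define n where "n = norm (y - x0)"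
    have n: "n > 1" using False by (simp add: n_def dist_norm norm_minus_commute)
    show ?thesis
    proof (cases "g y")
      case (real t)
      define z where "z = (1 - 1/n) *\<^sub>R x0 + (1/n) *\<^sub>R y"
      have "z - x0 = (1/n) *\<^sub>R (y - x0)" by (simp add: z_def algebra_simps)
      then have "norm (z - x0) = 1" using n by (auto simp: n_def)
      then have "g p \<le> g z" by (intro p(2)) (simp add: dist_norm norm_minus_commute)
      also have "g z \<le> ereal (1 - 1/n) * g x0 + ereal (1/n) * g y"
        using g(3) n unfolding convex_fun_def z_def by simp
      finally have "m \<le> (1 - 1/n) * a + (1/n) * t" by (simp add: m a real)
      then have "n * m \<le> n * ((1 - 1/n) * a + (1/n) * t)" using n by (intro mult_left_mono) auto
      also have "\<dots> = n * a - a + t" using n by (simp add: field_simps)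
      finally have "t \<ge> a - n * (a - m)" by (simp add: algebra_simps)
      moreover have "n * (a - m) \<le> n * C" using n by (intro mult_left_mono) (auto simp: C_def)
      moreover have "a \<ge> - C" by (simp add: C_def)
      ultimately have "- C * (1 + n) \<le> t" by (simp add: algebra_simps)
      then show ?thesis by (simp add: real n_def)
    qed (use g(1) in \<open>auto simp: proper_fun_def\<close>)
  qed
  moreover have "C \<ge> 0" by (simp add: C_def)
  ultimately show ?thesis using that by blast
qed

text \<open>\<open>prox\<close> is a choice operator, so a minimizer has to be shown to exist. The
  linear minorant of \<open>g\<close> loses to the quadratic term outside a large ball, and on that
  ball the infimum is attained.\<close>

lemma prox_is_minimizer:
  fixes g :: "'a::euclidean_space \<Rightarrow> ereal"
  assumes g: "proper_fun g" "lsc_fun g" "convex_fun g"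
  shows "g (prox g z) + ereal (1/2 * (norm (prox g z - z))\<^sup>2) \<le> g y + ereal (1/2 * (norm (y - z))\<^sup>2)"
proof -
  define h where "h = (\<lambda>y. g y + ereal (1/2 * (norm (y - z))\<^sup>2))"
  obtain x0 where x0: "x0 \<in> edom g" using g(1) by (auto simp: proper_fun_def)
  obtain C where C: "C \<ge> 0" "\<And>y. ereal (- C * (1 + norm (y - x0))) \<le> g y"
    using convex_lsc_linear_minorant[OF g x0] by blast
  obtain a where a: "h x0 = ereal a" using edom_real[OF g(1) x0] unfolding h_def
    by (metis plus_ereal.simps(1))
  define D where "D = C * (1 + norm (z - x0))"
  define E where "E = \<bar>a + D\<bar>"
  \<comment> \<open>For \<open>n > \<rho>\<close> this gives \<open>n \<ge> 1\<close> and
    \<open>n / 2 - C \<ge> E\<close>, hence \<open>n * (n / 2 - C) \<ge> E \<ge> a + D\<close>. The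
    term \<open>norm (x0 - z)\<close> puts \<open>x0\<close> inside the ball.\<close>
  define \<rho> where "\<rho> = 2 * C + 2 * E + norm (x0 - z) + 1"
  have E: "E \<ge> 0" by (simp add: E_def)
  have far: "h x0 \<le> h y" if "y \<notin> cball z \<rho>" for y
  proof -
    define n where "n = norm (y - z)"
    have n: "n > \<rho>" using that by (simp add: n_def dist_norm norm_minus_commute)
    have "norm (y - x0) \<le> n + norm (z - x0)"
      unfolding n_def using norm_triangle_ineq[of "y - z" "z - x0"] by simp
    then have "- C * (1 + norm (y - x0)) \<ge> - C * (1 + (n + norm (z - x0)))"
      using C(1) by (simp add: mult_left_mono)
    then have "- (C * n) - D \<le> - C * (1 + norm (y - x0))"
      by (simp add: D_def algebra_simps)
    with C(2) have "ereal (- (C * n) - D) \<le> g y" by (meson ereal_less_eq(3) order_trans)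
    then have "ereal (- (C * n) - D) + ereal (1/2 * n\<^sup>2) \<le> h y"
      unfolding h_def n_def by (rule add_right_mono)
    moreover have "a \<le> - (C * n) - D + 1/2 * n\<^sup>2"
    proof -
      have "1 * E \<le> n * (1/2 * n - C)"
      proof (rule mult_mono)
        show "E \<le> 1/2 * n - C"
          using n E C(1) norm_ge_zero[of "x0 - z"] unfolding \<rho>_def by linarith
        show "1 \<le> n"
          using n E C(1) norm_ge_zero[of "x0 - z"] unfolding \<rho>_def by linarith
      qed (simp_all add: n_def E_def)
      moreover have "a + D \<le> E" by (simp add: E_def)
      ultimately show ?thesis by (simp add: algebra_simps power2_eq_square)
    qed
    ultimately show ?thesis unfolding a by (metis ereal_less_eq(3) order_trans plus_ereal.simps(1))
  qed
  have "lsc_fun h" unfolding h_def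
    by (intro lsc_fun_add_continuous g continuous_intros)
  moreover have "x0 \<in> cball z \<rho>" using C(1) E by (simp add: \<rho>_def dist_norm norm_minus_commute)
  ultimately obtain p where p: "p \<in> cball z \<rho>" "\<forall>y\<in>cball z \<rho>. h p \<le> h y"
    using lsc_fun_attains_inf[of "cball z \<rho>" h] by (metis compact_cball empty_iff)
  have "h p \<le> h y" for y
    using p far[of y] \<open>x0 \<in> cball z \<rho>\<close> by (cases "y \<in> cball z \<rho>") (blast intro: order_trans)+
  then have "is_arg_min h (\<lambda>_. True) p" by (auto simp: is_arg_min_def not_less)
  then have "is_arg_min h (\<lambda>_. True) (prox g z)"
    unfolding prox_def arg_min_def h_def by (rule someI)
  then have "h (prox g z) \<le> h y" by (auto simp: is_arg_min_def not_less)
  then show ?thesis by (simp add: h_def)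
qed

lemma prox_in_edom:
  fixes g :: "'a::euclidean_space \<Rightarrow> ereal"
  assumes "proper_fun g" "lsc_fun g" "convex_fun g"
  shows "prox g z \<in> edom g"
proof -
  obtain x0 where "x0 \<in> edom g" using assms(1) by (auto simp: proper_fun_def)
  then show ?thesis using prox_is_minimizer[OF assms, of z x0]
    by (cases "g (prox g z)"; cases "g x0") (auto simp: edom_def)
qed

text \<open>This says that \<open>z - prox g z\<close> is a subgradient of \<open>g\<close> at
  \<open>prox g z\<close>. The minimizer is compared with the points at parameter \<open>t\<close>
  on the segment to \<open>y\<close>; after division by \<open>t\<close>, the quadratic remainder
  vanishes as \<open>t\<close> tends to 0.\<close>

lemma prox_variational_inequality:
  fixes g :: "'a::euclidean_space \<Rightarrow> ereal"
  assumes g: "proper_fun g" "lsc_fun g" "convex_fun g" and y: "y \<in> edom g"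
  shows "real_of_ereal (g (prox g z)) + (z - prox g z) \<bullet> (y - prox g z) \<le> real_of_ereal (g y)"
proof -
  define p where "p = prox g z"
  obtain P where P: "g p = ereal P" using edom_real[OF g(1) prox_in_edom[OF g]] p_def by metis
  obtain Y where Y: "g y = ereal Y" using edom_real[OF g(1) y] by metis
  have step: "P + (z - p) \<bullet> (y - p) - Y \<le> t * (1/2 * (norm (y - p))\<^sup>2)" if t: "0 < t" "t \<le> 1" for t
  proof -
    define w where "w = (1 - t) *\<^sub>R p + t *\<^sub>R y"
    have w: "g w \<le> ereal ((1 - t) * P + t * Y)"
    proof -
      have "g w \<le> ereal (1 - t) * g p + ereal t * g y"
        using g(3) t unfolding convex_fun_def w_def by simp
      then show ?thesis by (simp add: P Y)
    qed
    have "ereal (P + 1/2 * (norm (p - z))\<^sup>2) \<le> g w + ereal (1/2 * (norm (w - z))\<^sup>2)"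
      using prox_is_minimizer[OF g, of z w] P by (simp add: p_def[symmetric])
    also have "\<dots> \<le> ereal ((1 - t) * P + t * Y + 1/2 * (norm (w - z))\<^sup>2)"
      using add_right_mono[OF w, of "ereal (1/2 * (norm (w - z))\<^sup>2)"] by simp
    finally have "P + 1/2 * (norm (p - z))\<^sup>2 \<le> (1 - t) * P + t * Y + 1/2 * (norm (w - z))\<^sup>2"
      by simp
    moreover have wz: "w - z = (p - z) + t *\<^sub>R (y - p)" by (simp add: w_def algebra_simps)
    have "(norm (w - z))\<^sup>2 = (norm (p - z))\<^sup>2 + 2 * t * ((p - z) \<bullet> (y - p)) + t\<^sup>2 * (norm (y - p))\<^sup>2"
      unfolding wz using dot_norm[of "p - z" "t *\<^sub>R (y - p)"] by (simp add: power_mult_distrib)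
    moreover have "(p - z) \<bullet> (y - p) = - ((z - p) \<bullet> (y - p))"
      by (metis inner_minus_left minus_diff_eq)
    ultimately have "t * (P + (z - p) \<bullet> (y - p) - Y) \<le> t * (t * (1/2 * (norm (y - p))\<^sup>2))"
      by (simp add: algebra_simps power2_eq_square)
    then show ?thesis using t by simp
  qed
  have "((\<lambda>t. t * (1/2 * (norm (y - p))\<^sup>2)) \<longlongrightarrow> 0 * (1/2 * (norm (y - p))\<^sup>2)) (at_right 0)"
    by (intro tendsto_intros)
  moreover have "eventually (\<lambda>t. P + (z - p) \<bullet> (y - p) - Y \<le> t * (1/2 * (norm (y - p))\<^sup>2)) (at_right 0)"
    unfolding eventually_at_right_field using step by (intro exI[of _ 1]) auto
  ultimately have "P + (z - p) \<bullet> (y - p) - Y \<le> 0"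
    using tendsto_lowerbound by (metis mult_zero_left trivial_limit_at_right_real)
  then show ?thesis using P Y by (simp add: p_def)
qed

text \<open>The variational inequalities at the two points, each tested with the other point, add up
  to firm nonexpansiveness; Cauchy-Schwarz does the rest.\<close>

lemma prox_nonexpansive:
  fixes g :: "'a::euclidean_space \<Rightarrow> ereal"
  assumes g: "proper_fun g" "lsc_fun g" "convex_fun g"
  shows "norm (prox g z - prox g w) \<le> norm (z - w)"
proof -
  define p q where "p = prox g z" and "q = prox g w"
  have "real_of_ereal (g p) + (z - p) \<bullet> (q - p) \<le> real_of_ereal (g q)"
    "real_of_ereal (g q) + (w - q) \<bullet> (p - q) \<le> real_of_ereal (g p)"
    unfolding p_def q_def by (intro prox_variational_inequality prox_in_edom g)+
  then have "(p - q) \<bullet> (p - q) \<le> (z - w) \<bullet> (p - q)"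
    by (simp add: inner_diff_left inner_diff_right inner_commute)
  also have "\<dots> \<le> norm (z - w) * norm (p - q)" by (rule norm_cauchy_schwarz)
  finally have "norm (p - q) * norm (p - q) \<le> norm (z - w) * norm (p - q)"
    by (simp add: dot_square_norm power2_eq_square)
  then have "norm (p - q) \<le> norm (z - w)"
    by (cases "norm (p - q) = 0") (auto simp: mult_le_cancel_right)
  then show ?thesis by (simp add: p_def q_def)
qed

section \<open>Local bounds for the smooth part\<close>

text \<open>The \<open>norm\<close> of a matrix is here the Frobenius norm, so Cauchy-Schwarz is
  applied row by row.\<close>

lemma norm_matrix_vector_mult_le:
  fixes M :: "real^'n^'m"
  shows "norm (M *v v) \<le> norm M * norm v"
proof -
  have "norm (M *v v) = L2_set (\<lambda>i. norm (M $ i \<bullet> v)) UNIV"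
    by (simp add: norm_vec_def matrix_vector_mul_component)
  also have "\<dots> \<le> L2_set (\<lambda>i. norm (M $ i) * norm v) UNIV"
    by (intro L2_set_mono) (auto simp: Cauchy_Schwarz_ineq2)
  also have "\<dots> = norm M * norm v"
    unfolding norm_vec_def[of M] by (rule L2_set_left_distrib[symmetric]) simp
  finally show ?thesis .
qed

text \<open>If the least eigenvalue does not exist, \<^const>\<open>Least\<close> returns a value that is the same
  for all such matrices; hence no symmetry is required.\<close>

lemma lambda_min_bounded:
  obtains c where "\<And>M :: real^'n^'n. \<bar>lambda_min M\<bar> \<le> max c (norm M)"
proof -
  define c where "c = \<bar>THE l::real. False\<bar>"
  have "\<bar>lambda_min M\<bar> \<le> max c (norm M)" for M :: "real^'n^'n"
  proof -
    define P where "P = (\<lambda>l. \<exists>v. v \<noteq> 0 \<and> M *v v = l *\<^sub>R v)"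
    define Q where "Q = (\<lambda>l. P l \<and> (\<forall>y. P y \<longrightarrow> l \<le> y))"
    have lm: "lambda_min M = (THE l. Q l)"
      by (simp add: lambda_min_def Least_def P_def Q_def)
    show ?thesis
    proof (cases "\<exists>l. Q l")
      case True
      then obtain l where l: "Q l" by blast
      then have "lambda_min M = l" unfolding lm by (intro the_equality) (auto simp: Q_def order_antisym)
      moreover obtain v where v: "v \<noteq> 0" "M *v v = l *\<^sub>R v" using l by (auto simp: Q_def P_def)
      then have "\<bar>l\<bar> * norm v \<le> norm M * norm v"
        using norm_matrix_vector_mult_le[of M v] by simp
      then have "\<bar>l\<bar> \<le> norm M" using v(1) by simp
      ultimately show ?thesis by simp
    next
      case False
      then have "Q = (\<lambda>_. False)" by auto
      then show ?thesis by (simp add: lm c_def)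
    qed
  qed
  then show ?thesis using that by blast
qed

lemma gradient_eqI:
  assumes "gderiv (\<lambda>y. real_of_ereal (g y)) x D"
  shows "gradient g x = D"
  unfolding gradient_def
proof (rule the_equality)
  fix E assume "gderiv (\<lambda>y. real_of_ereal (g y)) x E"
  then have "(\<lambda>h. h \<bullet> E) = (\<lambda>h. h \<bullet> D)"
    using assms unfolding gderiv_def by (rule has_derivative_unique)
  then show "E = D" by (metis vector_eq_ldot)
qed (rule assms)

lemma gderiv_gradient:
  fixes g :: "'a::euclidean_space \<Rightarrow> ereal"
  assumes "(\<lambda>y. real_of_ereal (g y)) differentiable (at x)"
  shows "gderiv (\<lambda>y. real_of_ereal (g y)) x (gradient g x)"
proof -
  obtain D where D: "((\<lambda>y. real_of_ereal (g y)) has_derivative D) (at x)"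
    using assms by (auto simp: differentiable_def)
  interpret D: bounded_linear D using D by (rule has_derivative_bounded_linear)
  \<comment> \<open>The Riesz representative of the derivative, which shows that the description
    defining \<open>gradient\<close> denotes something.\<close>
  define E where "E = (\<Sum>b\<in>Basis. D b *\<^sub>R b)"
  have "D = (\<lambda>h. h \<bullet> E)"
  proof
    fix h
    have "D h = D (\<Sum>b\<in>Basis. (h \<bullet> b) *\<^sub>R b)" by (simp add: euclidean_representation)
    also have "\<dots> = h \<bullet> E"
      by (simp add: D.sum D.scaleR E_def inner_sum_right mult.commute)
    finally show "D h = h \<bullet> E" .
  qed
  then have "gderiv (\<lambda>y. real_of_ereal (g y)) x E" using D by (simp add: gderiv_def)
  then show ?thesis using gradient_eqI by metis
qed

lemma composite_derivatives:
  fixes A :: "real^'n^'m"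
  assumes U: "open U" "twice_cont_diff_on U \<psi>" and y: "A *v y - b \<in> U"
    and f: "f = (\<lambda>y. \<psi> (A *v y - b))"
  shows "((\<lambda>y. real_of_ereal (f y)) has_derivative (\<lambda>h. h \<bullet> gradient f y)) (at y)"
    and "gradient f y = transpose A *v gradient \<psi> (A *v y - b)"
    and "(gradient f has_derivative (\<lambda>h. hessian f y *v h)) (at y)"
    and "hessian f y = transpose A ** hessian \<psi> (A *v y - b) ** A"
proof -
  have aff: "((\<lambda>y. A *v y - b) has_derivative (\<lambda>h. A *v h)) (at z)" for z
    by (auto intro!: derivative_eq_intros bounded_linear.has_derivative[OF matrix_vector_mul_bounded_linear])
  have gd: "((\<lambda>y. real_of_ereal (f y)) has_derivative (\<lambda>h. h \<bullet> (transpose A *v gradient \<psi> (A *v z - b)))) (at z)"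
    if "A *v z - b \<in> U" for z
  proof -
    have "((\<lambda>w. real_of_ereal (\<psi> w)) has_derivative (\<lambda>h. h \<bullet> gradient \<psi> (A *v z - b))) (at (A *v z - b))"
      using gderiv_gradient that U(2) unfolding twice_cont_diff_on_def gderiv_def by blast
    moreover have "(A *v h) \<bullet> gradient \<psi> (A *v z - b) = h \<bullet> (transpose A *v gradient \<psi> (A *v z - b))" for h
      by (metis dot_lmul_matrix inner_commute transpose_matrix_vector)
    ultimately show ?thesis using has_derivative_compose[OF aff] by (fastforce simp: f)
  qed
  have gr: "gradient f z = transpose A *v gradient \<psi> (A *v z - b)" if "A *v z - b \<in> U" for z
    using gd[OF that] by (intro gradient_eqI) (simp add: gderiv_def)
  show "((\<lambda>y. real_of_ereal (f y)) has_derivative (\<lambda>h. h \<bullet> gradient f y)) (at y)"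
    and "gradient f y = transpose A *v gradient \<psi> (A *v y - b)"
    using gd gr y by simp_all
  have "(gradient \<psi> has_derivative (\<lambda>h. hessian \<psi> (A *v y - b) *v h)) (at (A *v y - b))"
    unfolding hessian_def using U(2) y by (simp add: twice_cont_diff_on_def jacobian_works)
  from bounded_linear.has_derivative[OF matrix_vector_mul_bounded_linear[of "transpose A"]
      has_derivative_compose[OF aff this]]
  have "((\<lambda>z. transpose A *v gradient \<psi> (A *v z - b)) has_derivative
      (\<lambda>h. (transpose A ** hessian \<psi> (A *v y - b) ** A) *v h)) (at y)"
    by (simp only: matrix_vector_mul_assoc matrix_mul_assoc)
  \<comment> \<open>The formula for \<open>gradient f\<close> is known only on this preimage; its
    openness allows the formula to be differentiated once more.\<close>
  moreover have "open ((\<lambda>z. A *v z - b) -` U)"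
    by (intro open_vimage U(1) continuous_intros)
  ultimately have *: "(gradient f has_derivative
      (\<lambda>h. (transpose A ** hessian \<psi> (A *v y - b) ** A) *v h)) (at y)"
    by (rule has_derivative_transform_within_open) (use gr y in auto)
  have "hessian f y = matrix (\<lambda>h. (transpose A ** hessian \<psi> (A *v y - b) ** A) *v h)"
    unfolding hessian_def[of f] jacobian_def using frechet_derivative_at[OF *] by simp
  then show "hessian f y = transpose A ** hessian \<psi> (A *v y - b) ** A"
    by simp
  then show "(gradient f has_derivative (\<lambda>h. hessian f y *v h)) (at y)"
    using * by simp
qed

lemma isCont_eventually_norm_less:
  fixes h :: "'a::t2_space \<Rightarrow> 'b::real_normed_vector"
  assumes "isCont h x"
  shows "eventually (\<lambda>y. norm (h y) < norm (h x) + 1) (nhds x)"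
proof -
  have "((\<lambda>y. norm (h y)) \<longlongrightarrow> norm (h x)) (nhds x)"
    using assms by (intro tendsto_norm) (simp add: isCont_def tendsto_at_iff_tendsto_nhds)
  then show ?thesis by (rule order_tendstoD) simp
qed

text \<open>Continuity at \<open>x\<close> bounds the Hessian of \<open>\<psi>\<close> on a small
  ball, which controls the least eigenvalue and the Hessian of \<open>f\<close>. Convexity of the
  ball then turns the Hessian bound into a Lipschitz bound for the gradient and a quadratic Taylor
  remainder.\<close>

lemma composite_local_bounds:
  fixes A :: "real^'n^'m"
  assumes U: "open U" "twice_cont_diff_on U \<psi>" and x: "A *v x - b \<in> U"
    and f: "f = (\<lambda>y. \<psi> (A *v y - b))"
  obtains s C where "s > 0" "C \<ge> 0"
    "\<And>y. y \<in> ball x s \<Longrightarrow> \<bar>real_of_ereal (f y)\<bar> \<le> C"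
    "\<And>y. y \<in> ball x s \<Longrightarrow> norm (gradient f y) \<le> C"
    "\<And>y v. y \<in> ball x s \<Longrightarrow> norm (hessian f y *v v) \<le> C * norm v"
    "\<And>y. y \<in> ball x s \<Longrightarrow> \<bar>lambda_min (hessian \<psi> (A *v y - b))\<bar> \<le> C"
    "\<And>y z. y \<in> ball x s \<Longrightarrow> z \<in> ball x s \<Longrightarrow>
      \<bar>real_of_ereal (f z) - real_of_ereal (f y) - gradient f y \<bullet> (z - y)\<bar> \<le> C * (norm (z - y))\<^sup>2"
proof -
  define fr where "fr = (\<lambda>y. real_of_ereal (f y))"
  define Hs where "Hs = (\<lambda>y. hessian \<psi> (A *v y - b))"
  note der = composite_derivatives[OF U _ f]
  have "isCont (hessian \<psi>) (A *v x - b)"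
    using U x by (auto simp: twice_cont_diff_on_def continuous_on_eq_continuous_at)
  then have "isCont Hs x"
    unfolding Hs_def by (rule isCont_o2[rotated]) (intro continuous_intros)
  moreover have "isCont fr x" "isCont (gradient f) x"
    using der(1,3)[OF x] unfolding fr_def by (auto intro: has_derivative_continuous)
  moreover have "open ((\<lambda>z. A *v z - b) -` U)"
    by (intro open_vimage U(1) continuous_intros)
  then have "eventually (\<lambda>y. A *v y - b \<in> U) (nhds x)"
    using x by (auto simp: eventually_nhds)
  ultimately have "eventually (\<lambda>y. norm (Hs y) < norm (Hs x) + 1 \<and> norm (fr y) < norm (fr x) + 1 \<and>
      norm (gradient f y) < norm (gradient f x) + 1 \<and> A *v y - b \<in> U) (nhds x)"
    by (intro eventually_conj isCont_eventually_norm_less)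
  then obtain s where s: "s > 0" and near: "\<And>y. y \<in> ball x s \<Longrightarrow> norm (Hs y) < norm (Hs x) + 1"
     "\<And>y. y \<in> ball x s \<Longrightarrow> norm (fr y) < norm (fr x) + 1"
     "\<And>y. y \<in> ball x s \<Longrightarrow> norm (gradient f y) < norm (gradient f x) + 1"
     "\<And>y. y \<in> ball x s \<Longrightarrow> A *v y - b \<in> U"
    unfolding eventually_nhds_metric by (auto simp: dist_commute)
  obtain c where c: "\<And>M :: real^'m^'m. \<bar>lambda_min M\<bar> \<le> max c (norm M)"
    using lambda_min_bounded by blast
  define K where "K = norm (Hs x) + 1"
  define B where "B = norm (transpose A) * K * norm A"
  define C where "C = \<bar>c\<bar> + K + B + (norm (fr x) + 1) + (norm (gradient f x) + 1)"
  have K: "K \<ge> 0" by (simp add: K_def)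
  have B: "B \<ge> 0" using K by (simp add: B_def)
  have C: "B \<le> C" "K \<le> C" "c \<le> C" "norm (fr x) + 1 \<le> C" "norm (gradient f x) + 1 \<le> C"
    using K B abs_ge_self[of c] abs_ge_zero[of c] norm_ge_zero[of "fr x"] norm_ge_zero[of "gradient f x"]
    unfolding C_def by linarith+
  have hess: "norm (hessian f y *v v) \<le> B * norm v" if y: "y \<in> ball x s" for y v
  proof -
    have "norm (hessian f y *v v) = norm (transpose A *v (Hs y *v (A *v v)))"
      by (simp add: der(4)[OF near(4)[OF y]] Hs_def matrix_vector_mul_assoc matrix_mul_assoc)
    also have "\<dots> \<le> norm (transpose A) * (K * (norm A * norm v))"
      by (intro order_trans[OF norm_matrix_vector_mult_le] mult_mono order_refl)
        (use near(1)[OF y] K in \<open>auto simp: K_def\<close>)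
    finally show ?thesis by (simp add: B_def mult_ac)
  qed
  \<comment> \<open>Mean value inequality twice: first for the gradient, then for \<open>fr\<close>
    minus its linear part at \<open>y\<close>, along the segment. The factor is \<open>B\<close>
    instead of \<open>B / 2\<close>, which suffices.\<close>
  have taylor: "\<bar>fr z - fr y - gradient f y \<bullet> (z - y)\<bar> \<le> B * (norm (z - y))\<^sup>2"
    if y: "y \<in> ball x s" and z: "z \<in> ball x s" for y z
  proof -
    have lip: "norm (gradient f w - gradient f y) \<le> B * norm (w - y)" if w: "w \<in> ball x s" for w
      by (rule differentiable_bound[OF convex_ball[of x s] _ _ w y, where f'="\<lambda>w h. hessian f w *v h"])
        (auto intro!: has_derivative_at_withinI der(3) near(4) onorm_bound hess B simp del: mem_ball)
    have sub: "closed_segment y z \<subseteq> ball x s" by (intro closed_segment_subset y z convex_ball)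
    have "norm ((fr z - z \<bullet> gradient f y) - (fr y - y \<bullet> gradient f y)) \<le> (B * norm (z - y)) * norm (z - y)"
    proof (rule differentiable_bound[OF convex_closed_segment,
          where f'="\<lambda>w h. h \<bullet> gradient f w - h \<bullet> gradient f y"])
      fix w assume "w \<in> closed_segment y z"
      then have w: "w \<in> ball x s" "norm (w - y) \<le> norm (z - y)"
        using sub segment_bound1[of w y z] by (auto simp: norm_minus_commute)
      show "((\<lambda>w. fr w - w \<bullet> gradient f y) has_derivative (\<lambda>h. h \<bullet> gradient f w - h \<bullet> gradient f y))
          (at w within closed_segment y z)"
        unfolding fr_def
        by (intro has_derivative_diff has_derivative_at_withinI[OF der(1)[OF near(4)[OF w(1)]]]
            has_derivative_inner_left has_derivative_ident)
      have "norm (h \<bullet> gradient f w - h \<bullet> gradient f y) \<le> B * norm (z - y) * norm h" for h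
      proof -
        have "norm (h \<bullet> (gradient f w - gradient f y)) \<le> norm h * norm (gradient f w - gradient f y)"
          by (simp add: Cauchy_Schwarz_ineq2)
        also have "\<dots> \<le> norm h * (B * norm (z - y))"
          using lip[OF w(1)] mult_left_mono[OF w(2) B] by (intro mult_left_mono) auto
        finally show ?thesis by (simp add: inner_diff_right mult_ac)
      qed
      then show "onorm (\<lambda>h. h \<bullet> gradient f w - h \<bullet> gradient f y) \<le> B * norm (z - y)"
        using B by (intro onorm_bound) auto
    qed auto
    moreover have "(fr z - z \<bullet> gradient f y) - (fr y - y \<bullet> gradient f y) =
        fr z - fr y - gradient f y \<bullet> (z - y)"
      by (simp add: inner_diff_right inner_commute)
    ultimately show ?thesis by (simp add: power2_eq_square mult_ac)
  qed
  show thesis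
  proof (rule that[OF s, of C])
    fix y assume y: "y \<in> ball x s"
    show "\<bar>real_of_ereal (f y)\<bar> \<le> C" "norm (gradient f y) \<le> C"
      using near(2,3)[OF y] C unfolding fr_def by auto
    show "\<bar>lambda_min (hessian \<psi> (A *v y - b))\<bar> \<le> C"
      using c[of "Hs y"] near(1)[OF y] C unfolding Hs_def K_def by (auto simp: max_def split: if_splits)
    show "norm (hessian f y *v v) \<le> C * norm v" for v
      using hess[OF y, of v] mult_right_mono[OF C(1), of "norm v"] by simp
    show "\<bar>real_of_ereal (f z) - real_of_ereal (f y) - gradient f y \<bullet> (z - y)\<bar> \<le> C * (norm (z - y))\<^sup>2"
      if z: "z \<in> ball x s" for z
      using taylor[OF y z] mult_right_mono[OF C(1), of "(norm (z - y))\<^sup>2"] unfolding fr_def by simp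
  qed (use B C in simp)
qed

section \<open>One step of the method\<close>

text \<open>The arguments of the two proximal maps differ by \<open>w - (y - x)\<close>, which
  nonexpansiveness preserves; replacing \<open>x\<close> by \<open>y\<close> in front costs another
  \<open>norm (y - x)\<close>. With \<open>v\<close> the gradient and \<open>w\<close> the image of
  the step under \<open>G k\<close>, it bounds the step length from below.\<close>

lemma residual_le_model_residual:
  fixes g :: "'a::euclidean_space \<Rightarrow> ereal"
  assumes "proper_fun g" "lsc_fun g" "convex_fun g"
  shows "norm (x - prox g (x - v)) \<le> norm (y - prox g (y - v - w)) + 2 * norm (y - x) + norm w"
proof -
  define p q where "p = prox g (x - v)" and "q = prox g (y - v - w)"
  have "norm (p - q) \<le> norm ((x - v) - (y - v - w))"
    unfolding p_def q_def by (rule prox_nonexpansive[OF assms])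
  also have "(x - v) - (y - v - w) = w - (y - x)" by simp
  also have "norm (w - (y - x)) \<le> norm w + norm (y - x)" by (rule norm_triangle_ineq4)
  finally have "norm (p - q) \<le> norm w + norm (y - x)" .
  moreover have "x - p = (y - q) - ((y - x) + (p - q))" by simp
  then have "norm (x - p) \<le> norm (y - q) + (norm (y - x) + norm (p - q))"
    using norm_triangle_ineq4[of "y - q" "(y - x) + (p - q)"] norm_triangle_ineq[of "y - x" "p - q"]
    by simp
  ultimately show ?thesis unfolding p_def q_def by linarith
qed

text \<open>Here \<open>n\<close> is the step length and \<open>\<omega>\<close> the residual norm; the third assumption says that long
  steps are unavoidable, and it is what makes the predicted reduction pass its test, since
  \<open>(1 + \<alpha>) / 2 > pmin\<close>.\<close>

lemma large_mu_accepts: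
  fixes \<alpha> c1 pmin \<theta> C L :: real
  assumes "0 < \<alpha>" "c1 < 1" "0 < pmin" "pmin < 1/2" "\<theta> < 1" "C \<ge> 0" "L \<ge> 0"
  obtains M where
    "\<And>\<mu> n \<omega> p a. \<lbrakk>\<mu> \<ge> M; (1 + \<alpha>) / 2 * \<mu> * n\<^sup>2 \<le> p; (1 - \<theta>) * \<omega> \<le> (2 + L + \<mu>) * n;
      \<bar>a - p\<bar> \<le> C * n\<^sup>2; \<omega> > 0; n \<ge> 0\<rbrakk> \<Longrightarrow> pmin * (1 - \<theta>) * n * \<omega> < p \<and> c1 * p < a"
proof -
  define \<beta> where "\<beta> = (1 + \<alpha>) / 2"
  \<comment> \<open>The first summand yields \<open>C < (1 - c1) * \<beta> * \<mu>\<close>, the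
    second \<open>pmin * (2 + L + \<mu>) < \<beta> * \<mu>\<close>; the final 1 makes both
    strict.\<close>
  define M where "M = C / ((1 - c1) * \<beta>) + pmin * (2 + L) / (\<beta> - pmin) + 1"
  have \<beta>: "\<beta> > 0" "\<beta> > pmin" using assms by (auto simp: \<beta>_def)
  have nonneg: "C / ((1 - c1) * \<beta>) \<ge> 0" "pmin * (2 + L) / (\<beta> - pmin) \<ge> 0"
    using assms \<beta> by auto
  have "pmin * (1 - \<theta>) * n * \<omega> < p \<and> c1 * p < a"
    if *: "\<mu> \<ge> M" "\<beta> * \<mu> * n\<^sup>2 \<le> p" "(1 - \<theta>) * \<omega> \<le> (2 + L + \<mu>) * n"
      "\<bar>a - p\<bar> \<le> C * n\<^sup>2" "\<omega> > 0" "n \<ge> 0" for \<mu> n \<omega> p a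
  proof
    have "C / ((1 - c1) * \<beta>) < \<mu>" "pmin * (2 + L) / (\<beta> - pmin) < \<mu>"
      using *(1) nonneg unfolding M_def by linarith+
    then have mu: "C < (1 - c1) * (\<beta> * \<mu>)" "pmin * (2 + L + \<mu>) < \<beta> * \<mu>"
      using assms \<beta> by (auto simp: field_simps)
    have pos: "0 < (1 - \<theta>) * \<omega>" using assms *(5) by simp
    then have "n \<noteq> 0" using *(3) by (intro notI) simp
    then have n: "n > 0" using *(6) by simp
    have "pmin * (1 - \<theta>) * n * \<omega> = pmin * n * ((1 - \<theta>) * \<omega>)" by simp
    also have "\<dots> \<le> pmin * n * ((2 + L + \<mu>) * n)"
      using *(3) n assms by (intro mult_left_mono) auto
    also have "\<dots> = pmin * (2 + L + \<mu>) * n\<^sup>2" by (simp add: power2_eq_square)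
    also have "\<dots> < \<beta> * \<mu> * n\<^sup>2" using mu(2) n by (intro mult_strict_right_mono) auto
    also have "\<dots> \<le> p" by (rule *(2))
    finally show "pmin * (1 - \<theta>) * n * \<omega> < p" .
    have "C * n\<^sup>2 < (1 - c1) * (\<beta> * \<mu>) * n\<^sup>2" using mu(1) n by (intro mult_strict_right_mono) auto
    also have "\<dots> = (1 - c1) * (\<beta> * \<mu> * n\<^sup>2)" by simp
    also have "\<dots> \<le> (1 - c1) * p" using *(2) assms by (intro mult_left_mono) auto
    finally show "c1 * p < a" using *(4) by (auto simp: algebra_simps abs_le_iff)
  qed
  then show ?thesis using that unfolding \<beta>_def by blast
qed

text \<open>For \<open>n \<ge> s\<close> the terms \<open>1\<close> and \<open>n\<close> are at most
  \<open>1 / s\<^sup>2\<close> and \<open>1 / s\<close> times \<open>n\<^sup>2\<close>, so the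
  right-hand side is at most a fixed multiple of \<open>n\<^sup>2\<close>, which a large
  \<open>\<mu>\<close> exceeds.\<close>

lemma large_mu_short_step:
  fixes \<alpha> D s :: real
  assumes "0 < \<alpha>" "0 < s" "0 \<le> D"
  obtains M where "\<And>\<mu> n. \<lbrakk>\<mu> \<ge> M; \<alpha> * \<mu> / 2 * n\<^sup>2 \<le> D * (1 + n + n\<^sup>2)\<rbrakk> \<Longrightarrow> n < s"
proof -
  define M where "M = 2 * (D * (1 / s\<^sup>2 + 1 / s + 1) + 1) / \<alpha>"
  have "n < s" if *: "\<mu> \<ge> M" "\<alpha> * \<mu> / 2 * n\<^sup>2 \<le> D * (1 + n + n\<^sup>2)" for \<mu> n
  proof (rule ccontr)
    assume "\<not> n < s"
    then have n: "n \<ge> s" by simp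
    then have "n > 0" using assms by simp
    have "1 = 1 / s\<^sup>2 * s\<^sup>2" using assms by simp
    also have "\<dots> \<le> 1 / s\<^sup>2 * n\<^sup>2" using n assms by (intro mult_left_mono power_mono) auto
    finally have "1 \<le> 1 / s\<^sup>2 * n\<^sup>2" .
    moreover have "n = 1 / s * (s * n)" using assms by simp
    moreover have "1 / s * (s * n) \<le> 1 / s * n\<^sup>2"
      using n assms \<open>n > 0\<close> by (intro mult_left_mono) (auto simp: power2_eq_square)
    ultimately have "1 + n + n\<^sup>2 \<le> (1 / s\<^sup>2 + 1 / s + 1) * n\<^sup>2" by (simp add: algebra_simps)
    then have "D * (1 + n + n\<^sup>2) \<le> D * ((1 / s\<^sup>2 + 1 / s + 1) * n\<^sup>2)"
      using assms by (intro mult_left_mono) auto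
    also have "\<dots> < (D * (1 / s\<^sup>2 + 1 / s + 1) + 1) * n\<^sup>2" using \<open>n > 0\<close> by (simp add: algebra_simps)
    also have "\<dots> = \<alpha> * M / 2 * n\<^sup>2" using assms by (simp add: M_def)
    also have "\<dots> \<le> \<alpha> * \<mu> / 2 * n\<^sup>2"
      using *(1) assms by (intro mult_right_mono divide_right_mono mult_left_mono) auto
    finally show False using *(2) by simp
  qed
  then show ?thesis using that by blast
qed

section \<open>Behaviour of the whole iteration\<close>

text \<open>From \<open>k0\<close> on, a rejection happens only below \<open>N\<close>, so it cannot
  lift the parameter above \<open>\<sigma> * N\<close>. Rejections from some index on would make it
  grow geometrically, against this bound.\<close>

lemma parameter_bounded_if_accepting:
  fixes \<nu> :: "nat \<Rightarrow> real"
  assumes \<sigma>: "\<sigma> > 1" and pos: "\<And>k. \<nu> k > 0"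
    and reject: "\<And>k. rejected k \<Longrightarrow> \<nu> (Suc k) = \<sigma> * \<nu> k"
    and accept: "\<And>k. \<not> rejected k \<Longrightarrow> \<nu> (Suc k) \<le> \<nu>max"
    and large: "\<And>k. k \<ge> k0 \<Longrightarrow> \<nu> k \<ge> N \<Longrightarrow> \<not> rejected k"
  obtains B where "\<And>k. k \<ge> k0 \<Longrightarrow> \<nu> k \<le> B" "\<And>K. \<exists>k\<ge>K. \<not> rejected k"
proof -
  define B where "B = max (\<nu> k0) (max (\<sigma> * N) \<nu>max)"
  have B: "\<nu> k \<le> B" if "k \<ge> k0" for k
    using that
  proof (induction k rule: dec_induct)
    case (step k)
    show ?case
    proof (cases "rejected k")
      case True
      then have "\<nu> k < N" using large[of k] step by (meson not_le)
      then have "\<sigma> * \<nu> k \<le> \<sigma> * N" using \<sigma> by simp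
      then show ?thesis using reject[OF True] by (simp add: B_def)
    next
      case False
      then show ?thesis using accept[of k] by (simp add: B_def)
    qed
  qed (simp add: B_def)
  have "\<exists>k\<ge>K. \<not> rejected k" for K
  proof (rule ccontr)
    assume "\<not> ?thesis"
    then have rej: "\<And>k. k \<ge> K \<Longrightarrow> rejected k" by blast
    define m where "m = max K k0"
    have pow: "\<nu> (m + j) = \<sigma> ^ j * \<nu> m" for j
      by (induction j) (simp_all add: reject[OF rej] m_def mult_ac)
    obtain j where "B / \<nu> m < \<sigma> ^ j" using real_arch_pow[OF \<sigma>] by blast
    then have "B < \<nu> (m + j)" using pos[of m] by (simp add: pow pos_divide_less_eq)
    moreover have "k0 \<le> m + j" by (simp add: m_def)
    ultimately show False using B[of "m + j"] by simp
  qed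
  then show ?thesis using B that by blast
qed

text \<open>The decreases of \<open>V\<close> form a convergent telescoping series that dominates
  the step lengths, so the path has finite length and completeness gives a limit.\<close>

lemma convergent_if_descent_dominates_steps:
  fixes x :: "nat \<Rightarrow> 'a::banach"
  assumes c: "c > 0" and step: "\<And>k. c * norm (x (Suc k) - x k) \<le> V k - V (Suc k)"
    and below: "\<And>k. m \<le> V k"
  shows "convergent V" "convergent x"
proof -
  have "V (Suc k) \<le> V k" for k
  proof -
    have "0 \<le> c * norm (x (Suc k) - x k)" using c by simp
    then show ?thesis using step[of k] by linarith
  qed
  then have dec: "decseq V" by (rule decseq_SucI)
  obtain l where l: "V \<longlonglongrightarrow> l" using decseq_convergent[OF dec, of m] below by metis
  then show "convergent V" by (auto simp: convergent_def)
  have "norm (x (Suc k) - x k) \<le> (V k - V (Suc k)) / c" for k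
    using step[of k] c by (simp add: field_simps)
  then have "summable (\<lambda>k. norm (x (Suc k) - x k))"
    by (intro summable_comparison_test[OF _ summable_divide[OF telescope_summable'[OF l]]]) auto
  then have "summable (\<lambda>k. x (Suc k) - x k)" by (rule summable_norm_cancel)
  then obtain z where "(\<lambda>n. \<Sum>k<n. x (Suc k) - x k) \<longlonglongrightarrow> z"
    unfolding summable_def sums_def by blast
  then have "(\<lambda>n. x n - x 0) \<longlonglongrightarrow> z"
    unfolding sum_lessThan_telescope[of x] .
  then have "(\<lambda>n. (x n - x 0) + x 0) \<longlonglongrightarrow> z + x 0"
    by (intro tendsto_intros)
  then show "convergent x" by (auto simp: convergent_def)
qed

theorem theorem11:
  fixes A :: "real^'n^'m" and b :: "real^'m"
    and \<psi> :: "real^'m \<Rightarrow> ereal" and \<phi> f F :: "real^'n \<Rightarrow> ereal"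
    and \<Omega> :: "(real^'n) set" and U :: "(real^'m) set"
    and c1 c2 \<sigma>1 \<sigma>2 \<eta> \<theta> \<alpha> a \<nu>min \<nu>max \<delta> \<tau> pmin \<kappa> :: real
    and x xhat d :: "nat \<Rightarrow> real^'n"
    and r :: "real^'n \<Rightarrow> real^'n" and R :: "nat \<Rightarrow> real^'n \<Rightarrow> real^'n"
    and \<Lambda> \<mu> \<nu> rbar :: "nat \<Rightarrow> real"
    and H G :: "nat \<Rightarrow> real^'n^'n"
    and q qhat :: "nat \<Rightarrow> real^'n \<Rightarrow> ereal"
    and pred ared \<rho> :: "nat \<Rightarrow> ereal"
    and unsuccessful :: "nat \<Rightarrow> bool"
  assumes psi: "proper_fun \<psi>" "lsc_fun \<psi>"
    and phi: "proper_fun \<phi>" "lsc_fun \<phi>" "convex_fun \<phi>" "continuous_on (edom \<phi>) \<phi>"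
    and f_eq: "\<And>y. f y = \<psi> (A *v y - b)"
    and F_eq: "\<And>y. F y = f y + \<phi> y"
    and Omega: "closed \<Omega>" "edom \<phi> \<subseteq> \<Omega>"
    and U: "open U" "(\<lambda>y. A *v y - b) ` \<Omega> \<subseteq> U" "twice_cont_diff_on U \<psi>"
    and F_bounded_below: "(INF y. F y) > -\<infinity>"
    and r_eq: "\<And>y. r y = residual f \<phi> y"
    and parameters: "0 < c1" "c1 < c2" "c2 < 1" "0 < \<sigma>1" "\<sigma>1 < 1" "\<sigma>2 > 1"
      "0 < \<eta>" "\<eta> < 1" "0 < \<theta>" "\<theta> < 1" "0 < \<alpha>" "\<alpha> < 1" "a \<ge> 1"
      "0 < \<nu>min" "\<nu>min \<le> \<nu> 0" "\<nu> 0 \<le> \<nu>max"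
      "0 < \<delta>" "\<delta> \<le> 1" "\<tau> \<ge> \<delta>" "0 < pmin" "pmin < 1/2" "\<kappa> > 1 + \<delta>"
    and initial: "x 0 \<in> edom \<phi>" "rbar 0 = norm (r (x 0))" "\<mu> 0 = \<nu> 0 * rbar 0 powr \<delta>"
    and Lambda_eq: "\<And>k. \<Lambda> k = a * max 0 (- lambda_min (hessian \<psi> (A *v x k - b)))"
    and H_eq: "\<And>k. H k = hessian f (x k) + \<Lambda> k *\<^sub>R (transpose A ** A)"
    and G_eq: "\<And>k. G k = H k + \<mu> k *\<^sub>R mat 1"
    and q_eq: "\<And>k y. q k y = f (x k) + ereal (gradient f (x k) \<bullet> (y - x k)
                 + 1/2 * ((y - x k) \<bullet> (hessian f (x k) *v (y - x k)))) + \<phi> y"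
    and qhat_eq: "\<And>k y. qhat k y = f (x k) + ereal (gradient f (x k) \<bullet> (y - x k)
                 + 1/2 * ((y - x k) \<bullet> (G k *v (y - x k)))) + \<phi> y"
    and R_eq: "\<And>k y. R k y = y - prox \<phi> (y - gradient f (x k) - G k *v (y - x k))"
    and step1: "\<And>k. norm (R k (xhat k)) \<le> \<theta> * min (norm (r (x k))) (norm (r (x k)) powr (1 + \<tau>))"
      "\<And>k. F (x k) - qhat k (xhat k) \<ge> ereal (\<alpha> * \<mu> k / 2 * (norm (xhat k - x k))\<^sup>2)"
    and step2: "\<And>k. d k = xhat k - x k"
      "\<And>k. pred k = F (x k) - q k (xhat k)"
      "\<And>k. ared k = F (x k) - F (xhat k)"
      "\<And>k. \<rho> k = ared k / pred k"
    and unsuccessful_iff: "\<And>k. unsuccessful k \<longleftrightarrow>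
        pred k \<le> ereal (pmin * (1 - \<theta>) * norm (d k) * min (norm (r (x k))) (norm (r (x k)) powr \<kappa>))
        \<or> \<rho> k \<le> ereal c1"
    and step3: "\<And>k. x (Suc k) = (if unsuccessful k then x k else xhat k)"
      "\<And>k. \<nu> (Suc k) = (if unsuccessful k then \<sigma>2 * \<nu> k
             else if \<rho> k \<le> ereal c2 then min (\<nu> k) \<nu>max
             else min (max (\<sigma>1 * \<nu> k) \<nu>min) \<nu>max)"
    and step4: "\<And>k. rbar (Suc k) = (if norm (r (x (Suc k))) \<le> \<eta> * rbar k
             then norm (r (x (Suc k))) else rbar k)"
      "\<And>k. \<mu> (Suc k) = \<nu> (Suc k) * rbar (Suc k) powr \<delta>"
    and nonstationary: "\<And>k. r (x k) \<noteq> 0"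
  shows "liminf (\<lambda>k. ereal (norm (r (x k)))) = 0"
proof (rule ccontr)
  assume contra: "liminf (\<lambda>k. ereal (norm (r (x k)))) \<noteq> 0"

  \<comment> \<open>Real-valued counterparts on the domain of \<open>\<phi>\<close>\<close>
  define fr \<phi>r Fr where "fr = (\<lambda>y. real_of_ereal (f y))" and "\<phi>r = (\<lambda>y. real_of_ereal (\<phi> y))"
    and "Fr = (\<lambda>y. fr y + \<phi>r y)"
  define \<omega> n where "\<omega> k = norm (r (x k))" and "n k = norm (d k)" for k
  define hd where "hd k = d k \<bullet> (hessian f (x k) *v d k)" for k
  define pr ar where "pr k = \<phi>r (x k) - \<phi>r (xhat k) - (gradient f (x k) \<bullet> d k + 1/2 * hd k)"
    and "ar k = Fr (x k) - Fr (xhat k)" for k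
  have f_fun: "f = (\<lambda>y. \<psi> (A *v y - b))" by (simp add: f_eq fun_eq_iff)
  have fE: "f y = ereal (fr y)" if "y \<in> edom \<phi>" for y
  proof -
    have "A *v y - b \<in> U" using that Omega(2) U(2) by blast
    then have "\<bar>f y\<bar> \<noteq> \<infinity>" using U(3) by (simp add: f_eq twice_cont_diff_on_def)
    then show ?thesis by (simp add: fr_def ereal_real)
  qed
  have \<phi>E: "\<phi> y = ereal (\<phi>r y)" if "y \<in> edom \<phi>" for y
    using edom_real[OF phi(1) that] by (simp add: \<phi>r_def)
  have FE: "F y = ereal (Fr y)" if "y \<in> edom \<phi>" for y
    using fE[OF that] \<phi>E[OF that] by (simp add: F_eq Fr_def)
  \<comment> \<open>A trial point outside the domain would make the model decrease minus infinity,
    against the descent condition. The premise on \<open>x k\<close> is removed after the induction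
    for \<open>x_dom\<close>.\<close>
  have xhat_dom: "xhat k \<in> edom \<phi>" if "x k \<in> edom \<phi>" for k
  proof (rule ccontr)
    assume "xhat k \<notin> edom \<phi>"
    then have "\<phi> (xhat k) = \<infinity>" by (simp add: edom_def)
    then have "F (x k) - qhat k (xhat k) = -\<infinity>"
      by (simp add: qhat_eq FE[OF that] fE[OF that])
    then show False using step1(2)[of k] by simp
  qed
  have x_dom: "x k \<in> edom \<phi>" for k
    by (induction k) (auto simp: initial(1) step3(1) xhat_dom)
  note xhat_dom = xhat_dom[OF x_dom]
  have n_nonneg: "n k \<ge> 0" for k by (simp add: n_def)

  \<comment> \<open>Predicted, actual and model reduction\<close>
  have predE: "pred k = ereal (pr k)" for k
    by (simp add: step2(2) q_eq FE fE \<phi>E x_dom xhat_dom pr_def Fr_def hd_def step2(1)[symmetric])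
  have aredE: "ared k = ereal (ar k)" for k
    by (simp add: step2(3) FE x_dom xhat_dom ar_def)
  have Gv: "G k *v v = hessian f (x k) *v v + \<Lambda> k *\<^sub>R (transpose A *v (A *v v)) + \<mu> k *\<^sub>R v" for k v
    by (simp add: G_eq H_eq matrix_vector_mult_add_rdistrib scaleR_matrix_vector_assoc[symmetric]
        matrix_vector_mul_assoc del: transpose_matrix_vector)
  have vAAv: "v \<bullet> (transpose A *v (A *v v)) = (norm (A *v v))\<^sup>2" for v
    by (metis dot_lmul_matrix dot_square_norm inner_commute transpose_matrix_vector)
  have Gd: "d k \<bullet> (G k *v d k) = hd k + \<Lambda> k * (norm (A *v d k))\<^sup>2 + \<mu> k * (n k)\<^sup>2" for k
    unfolding Gv inner_add_right inner_scaleR_right vAAv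
    by (simp add: hd_def n_def power2_norm_eq_inner)
  have model_decrease: "\<alpha> * \<mu> k / 2 * (n k)\<^sup>2 \<le> pr k - 1/2 * (\<Lambda> k * (norm (A *v d k))\<^sup>2 + \<mu> k * (n k)\<^sup>2)" for k
  proof -
    have "F (x k) - qhat k (xhat k) =
        ereal (\<phi>r (x k) - \<phi>r (xhat k) - (gradient f (x k) \<bullet> d k + 1/2 * (d k \<bullet> (G k *v d k))))"
      by (simp add: qhat_eq FE fE \<phi>E x_dom xhat_dom Fr_def step2(1)[symmetric])
    then show ?thesis using step1(2)[of k]
      by (simp add: Gd pr_def step2(1)[symmetric] n_def[symmetric] algebra_simps)
  qed
  have \<Lambda>_nonneg: "\<Lambda> k \<ge> 0" for k using parameters(13) by (simp add: Lambda_eq)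
  \<comment> \<open>One half of the factor \<open>1 + \<alpha>\<close> comes from the term
    \<open>\<mu> k\<close> in \<open>G k\<close>, which \<open>q\<close> lacks;
    \<open>\<alpha> / 2\<close> comes from the descent condition.\<close>
  have pr_ge: "(1 + \<alpha>) / 2 * \<mu> k * (n k)\<^sup>2 \<le> pr k" for k
  proof -
    have "\<Lambda> k * (norm (A *v d k))\<^sup>2 \<ge> 0" using \<Lambda>_nonneg by simp
    then show ?thesis using model_decrease[of k] by (simp add: field_simps)
  qed

  \<comment> \<open>Uniform bounds on residuals and regularization\<close>
  obtain \<epsilon> where \<epsilon>: "\<epsilon> > 0" "\<And>k. \<epsilon> \<le> \<omega> k"
  proof -
    have "0 \<le> liminf (\<lambda>k. ereal (norm (r (x k))))" by (intro Liminf_bounded) simp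
    with contra have "0 < liminf (\<lambda>k. ereal (norm (r (x k))))" by simp
    then obtain c where c: "0 < ereal c" "ereal c < liminf (\<lambda>k. ereal (norm (r (x k))))"
      using ereal_dense2 by blast
    obtain k0 where k0: "\<And>k. k \<ge> k0 \<Longrightarrow> c < \<omega> k"
      using less_LiminfD[OF c(2)] by (auto simp: eventually_sequentially \<omega>_def)
    \<comment> \<open>The limit inferior bounds only the tail; the minimum over the finitely many
      earlier residuals, all nonzero, extends the bound to every index.\<close>
    define \<epsilon> where "\<epsilon> = min c (Min (\<omega> ` {..k0}))"
    have "\<epsilon> > 0" using c(1) nonstationary by (simp add: \<epsilon>_def \<omega>_def)
    moreover have "\<epsilon> \<le> \<omega> k" for k
    proof (cases "k \<le> k0")
      case True
      then have "Min (\<omega> ` {..k0}) \<le> \<omega> k" by (intro Min_le) auto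
      then show ?thesis by (simp add: \<epsilon>_def)
    qed (use k0[of k] in \<open>simp add: \<epsilon>_def\<close>)
    ultimately show ?thesis using that by blast
  qed
  have \<omega>_pos: "\<omega> k > 0" for k using \<epsilon>(1) \<epsilon>(2)[of k] by linarith
  have rbar: "\<epsilon> \<le> rbar k \<and> rbar k \<le> rbar 0" for k
  proof (induction k)
    case 0
    show ?case using \<epsilon>(2)[of 0] by (simp add: initial(2) \<omega>_def)
  next
    case (Suc k)
    have "\<eta> * rbar k \<le> 1 * rbar k"
      using Suc parameters(8) \<epsilon>(1) by (intro mult_right_mono) auto
    then show ?case using Suc \<epsilon>(2)[of "Suc k"] by (auto simp: step4(1) \<omega>_def)
  qed
  have \<nu>_pos: "\<nu> k > 0" for k
  proof (induction k)
    case 0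
    show ?case using parameters(14,15) by linarith
  next
    case (Suc k)
    have "\<nu>max > 0" using parameters(14-16) by linarith
    with Suc show ?case using parameters(6,14)
      by (simp add: step3(2) less_max_iff_disj)
  qed
  have \<mu>_eq: "\<mu> k = \<nu> k * rbar k powr \<delta>" for k
    by (cases k) (simp_all add: initial(3) step4(2))
  \<comment> \<open>Since \<open>rbar\<close> stays between \<open>\<epsilon>\<close> and
    \<open>rbar 0\<close>, \<open>\<mu>\<close> and \<open>\<nu>\<close> are comparable up to fixed
    factors.\<close>
  have \<mu>_ge: "\<nu> k * \<epsilon> powr \<delta> \<le> \<mu> k" and \<mu>_le: "\<mu> k \<le> \<nu> k * rbar 0 powr \<delta>" for k
    unfolding \<mu>_eq using rbar[of k] \<epsilon>(1) \<nu>_pos[of k] parameters(17)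
    by (auto intro!: mult_left_mono powr_mono2)
  have \<mu>_pos: "\<mu> k > 0" for k
    using \<nu>_pos[of k] rbar[of k] \<epsilon>(1) by (simp add: \<mu>_eq)

  \<comment> \<open>The acceptance test in real terms\<close>
  have acceptI: "\<not> unsuccessful k"
    if "pmin * (1 - \<theta>) * n k * \<omega> k < pr k" "c1 * pr k < ar k" for k
  proof -
    have "pmin * (1 - \<theta>) * n k * min (\<omega> k) (\<omega> k powr \<kappa>) \<le> pmin * (1 - \<theta>) * n k * \<omega> k"
      using parameters(10,20) n_nonneg[of k] by (intro mult_left_mono) auto
    \<comment> \<open>With the first premise this makes \<open>pr k\<close> positive, so the ratio
      test can be multiplied out.\<close>
    moreover have "0 \<le> pmin * (1 - \<theta>) * n k * \<omega> k"
      using parameters(10,20) n_nonneg[of k] \<omega>_pos[of k] by simp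
    ultimately show ?thesis using that
      by (simp add: unsuccessful_iff step2(4) predE aredE n_def[symmetric] \<omega>_def[symmetric]
          pos_le_divide_eq not_le pos_less_divide_eq)
  qed
  \<comment> \<open>Acceptance gives \<open>ar k > c1 * pr k\<close> and bounds \<open>pr k\<close>
    below by the reduction test; inserting \<open>\<epsilon>\<close> for the residual leaves
    \<open>c * n k\<close>.\<close>
  define c where "c = c1 * (pmin * (1 - \<theta>) * min \<epsilon> (\<epsilon> powr \<kappa>))"
  have c: "c > 0" using parameters(1,10,20) \<epsilon>(1) by (simp add: c_def)
  have acceptD: "c * n k \<le> ar k" if acc: "\<not> unsuccessful k" for k
  proof -
    have lb: "pmin * (1 - \<theta>) * n k * min (\<omega> k) (\<omega> k powr \<kappa>) < pr k" and "\<not> \<rho> k \<le> ereal c1"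
      using acc by (simp_all add: unsuccessful_iff predE n_def \<omega>_def not_le)
    have "0 \<le> pmin * (1 - \<theta>) * n k * min (\<omega> k) (\<omega> k powr \<kappa>)"
      using parameters(10,20) n_nonneg[of k] \<omega>_pos[of k] by simp
    with lb have "pr k > 0" by linarith
    then have "c1 * pr k < ar k"
      using \<open>\<not> \<rho> k \<le> ereal c1\<close> by (simp add: step2(4) predE aredE pos_less_divide_eq not_le)
    have "min \<epsilon> (\<epsilon> powr \<kappa>) \<le> min (\<omega> k) (\<omega> k powr \<kappa>)"
      using \<epsilon>(1) \<epsilon>(2)[of k] parameters(17,22) by (intro min.mono powr_mono2) auto
    then have "c1 * (pmin * (1 - \<theta>) * n k * min \<epsilon> (\<epsilon> powr \<kappa>))
        \<le> c1 * (pmin * (1 - \<theta>) * n k * min (\<omega> k) (\<omega> k powr \<kappa>))"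
      using parameters(1,10,20) n_nonneg[of k] by (intro mult_left_mono) auto
    also have "\<dots> \<le> c1 * pr k" using lb parameters(1) by simp
    also have "c1 * (pmin * (1 - \<theta>) * n k * min \<epsilon> (\<epsilon> powr \<kappa>)) = c * n k"
      by (simp add: c_def)
    finally show ?thesis using \<open>c1 * pr k < ar k\<close> by linarith
  qed

  \<comment> \<open>Convergence of the iterates\<close>
  define V where "V k = Fr (x k)" for k
  \<comment> \<open>At a rejected iteration both sides are 0, so the bound holds for every
    index.\<close>
  have descent: "c * norm (x (Suc k) - x k) \<le> V k - V (Suc k)" for k
    using acceptD[of k] by (simp add: step3(1) V_def ar_def n_def step2(1))
  obtain m where "ereal m < (INF y. F y)" using ereal_dense2[OF F_bounded_below] by blast
  then have V_ge: "m \<le> V k" for k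
    using less_le_trans[OF _ INF_lower[of "x k" UNIV F]] by (fastforce simp: FE x_dom V_def)
  obtain xbar where xbar: "x \<longlonglongrightarrow> xbar" and V_conv: "convergent V"
    using convergent_if_descent_dominates_steps[where V=V and x=x, OF c descent V_ge] by (auto simp: convergent_def)
  have V_le: "V k \<le> V 0" for k
  proof (induction k)
    case (Suc k)
    have "0 \<le> c * norm (x (Suc k) - x k)" using c by simp
    then show ?case using descent[of k] Suc by linarith
  qed simp

  \<comment> \<open>Derivative bounds near the limit\<close>
  have "xbar \<in> \<Omega>"
    using closed_sequentially[OF Omega(1) _ xbar] x_dom Omega(2) by blast
  then have inU: "A *v xbar - b \<in> U" using U(2) by blast
  obtain s C where s: "s > 0" and C: "C \<ge> 0"
    and f_bound: "\<And>y. y \<in> ball xbar s \<Longrightarrow> \<bar>fr y\<bar> \<le> C"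
    and grad_bound: "\<And>y. y \<in> ball xbar s \<Longrightarrow> norm (gradient f y) \<le> C"
    and hess_bound: "\<And>y v. y \<in> ball xbar s \<Longrightarrow> norm (hessian f y *v v) \<le> C * norm v"
    and lam_bound: "\<And>y. y \<in> ball xbar s \<Longrightarrow> \<bar>lambda_min (hessian \<psi> (A *v y - b))\<bar> \<le> C"
    and taylor: "\<And>y z. y \<in> ball xbar s \<Longrightarrow> z \<in> ball xbar s \<Longrightarrow>
      \<bar>fr z - fr y - gradient f y \<bullet> (z - y)\<bar> \<le> C * (norm (z - y))\<^sup>2"
  proof (rule composite_local_bounds[OF U(1,3) inU f_fun], goal_cases)
    case (1 s C)
    show ?case by (rule that[of s C, unfolded fr_def]) (fact 1)+
  qed
  \<comment> \<open>Half the radius is kept in reserve, so that a trial step shorter than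
    \<open>s / 2\<close> stays in the ball.\<close>
  obtain k0 where k0: "\<And>k. k \<ge> k0 \<Longrightarrow> dist (x k) xbar < s / 2"
    using metric_LIMSEQ_D[OF xbar, of "s / 2"] s by auto
  have x_ball: "x k \<in> ball xbar s" if "k \<ge> k0" for k
    using k0[OF that] s by (simp add: dist_commute)
  have hd_bound: "\<bar>hd k\<bar> \<le> C * (n k)\<^sup>2" if "k \<ge> k0" for k
  proof -
    have "\<bar>hd k\<bar> \<le> n k * norm (hessian f (x k) *v d k)"
      unfolding hd_def n_def by (rule Cauchy_Schwarz_ineq2)
    also have "\<dots> \<le> n k * (C * n k)"
      unfolding n_def by (intro mult_left_mono hess_bound x_ball that) simp
    finally show ?thesis by (simp add: power2_eq_square mult_ac)
  qed

  \<comment> \<open>Lower bound on the step length\<close>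
  define L where "L = C + a * C * norm (transpose A) * norm A"
  have L: "L \<ge> 0" using C parameters(13) by (simp add: L_def)
  \<comment> \<open>\<open>L\<close> bounds the action of \<open>H k\<close>: \<open>C\<close> for
    the Hessian of \<open>f\<close>, and \<open>a * C\<close> for \<open>\<Lambda> k\<close> times
    the norms of the two factors. The inexactness contributes at most
    \<open>\<theta> * \<omega> k\<close>, which moves to the left.\<close>
  have step_long: "(1 - \<theta>) * \<omega> k \<le> (2 + L + \<mu> k) * n k" if k: "k \<ge> k0" for k
  proof -
    have "\<Lambda> k \<le> a * C"
      unfolding Lambda_eq using lam_bound[OF x_ball[OF k]] C parameters(13) by (intro mult_left_mono) auto
    moreover have "norm (transpose A *v (A *v d k)) \<le> norm (transpose A) * (norm A * n k)"
      unfolding n_def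
      by (intro order_trans[OF norm_matrix_vector_mult_le] mult_left_mono norm_matrix_vector_mult_le) simp
    ultimately have "\<Lambda> k * norm (transpose A *v (A *v d k)) \<le> a * C * (norm (transpose A) * (norm A * n k))"
      using \<Lambda>_nonneg[of k] C parameters(13) by (intro mult_mono) auto
    moreover have "norm (hessian f (x k) *v d k) \<le> C * n k"
      unfolding n_def by (rule hess_bound[OF x_ball[OF k]])
    moreover have "norm (G k *v d k) \<le> norm (hessian f (x k) *v d k)
        + \<Lambda> k * norm (transpose A *v (A *v d k)) + \<mu> k * n k"
      unfolding Gv n_def using \<Lambda>_nonneg[of k] \<mu>_pos[of k]
      by (intro norm_triangle_le add_mono) (simp_all del: transpose_matrix_vector)
    ultimately have "norm (G k *v d k) \<le> (L + \<mu> k) * n k"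
      by (simp add: L_def algebra_simps del: transpose_matrix_vector)
    moreover have "\<omega> k \<le> norm (R k (xhat k)) + 2 * n k + norm (G k *v d k)"
      unfolding \<omega>_def n_def r_eq residual_def R_eq step2(1)
      by (rule residual_le_model_residual[OF phi(1,2,3)])
    moreover have "norm (R k (xhat k)) \<le> \<theta> * \<omega> k"
    proof -
      have "\<theta> * min (\<omega> k) (\<omega> k powr (1 + \<tau>)) \<le> \<theta> * \<omega> k"
        using parameters(9) by (intro mult_left_mono) auto
      then show ?thesis using step1(1)[of k] unfolding \<omega>_def by linarith
    qed
    ultimately show ?thesis by (simp add: algebra_simps)
  qed

  \<comment> \<open>Growth bound on the trial step\<close>
  obtain K where K: "K \<ge> 0" "\<And>y. ereal (- K * (1 + norm (y - x 0))) \<le> \<phi> y"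
    using convex_lsc_linear_minorant[OF phi(1,2,3) initial(1)] by blast
  define E where "E = norm (xbar - x 0) + s"
  \<comment> \<open>\<open>D\<close> dominates each coefficient:
    \<open>\<bar>V 0\<bar> + C + K * (1 + E)\<close> of the constant, \<open>K + C\<close> of
    \<open>n k\<close>, and \<open>C\<close> of its square. \<open>E\<close> bounds the distance
    from \<open>x k\<close> to \<open>x 0\<close>.\<close>
  define D where "D = \<bar>V 0\<bar> + C + K * (1 + E) + K + C"
  have E: "E \<ge> 0" using s by (simp add: E_def)
  have D: "D \<ge> 0" using C K(1) E by (simp add: D_def)
  \<comment> \<open>The trial point is not yet known to be near \<open>xbar\<close>, so
    \<open>\<phi>\<close> is bounded there only by its linear minorant, and \<open>f\<close> enters
    only through its data at \<open>x k\<close>.\<close>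
  have growth: "\<alpha> * \<mu> k / 2 * (n k)\<^sup>2 \<le> D * (1 + n k + (n k)\<^sup>2)" if k: "k \<ge> k0" for k
  proof -
    have "norm (x k - xbar) \<le> s" using x_ball[OF k] by (simp add: dist_norm norm_minus_commute)
    then have "norm (xhat k - x 0) \<le> n k + E"
      using norm_triangle_ineq[of "d k" "x k - x 0"] norm_triangle_ineq[of "x k - xbar" "xbar - x 0"]
      unfolding n_def E_def by (simp add: step2(1))
    then have "K * (1 + norm (xhat k - x 0)) \<le> K * (1 + (n k + E))"
      using K(1) by (intro mult_left_mono) auto
    moreover have "- (K * (1 + norm (xhat k - x 0))) \<le> \<phi>r (xhat k)"
      using K(2)[of "xhat k"] \<phi>E[OF xhat_dom[of k]] by simp
    ultimately have 1: "- \<phi>r (xhat k) \<le> K * (1 + E) + K * n k"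
      by (simp add: algebra_simps)
    have 2: "\<phi>r (x k) \<le> \<bar>V 0\<bar> + C"
      using V_le[of k] f_bound[OF x_ball[OF k]] unfolding V_def Fr_def by linarith
    have "\<bar>gradient f (x k) \<bullet> d k\<bar> \<le> norm (gradient f (x k)) * n k"
      unfolding n_def by (rule Cauchy_Schwarz_ineq2)
    also have "\<dots> \<le> C * n k"
      using grad_bound[OF x_ball[OF k]] n_nonneg[of k] by (rule mult_right_mono)
    finally have 3: "- (gradient f (x k) \<bullet> d k) \<le> C * n k" by linarith
    have "\<Lambda> k * (norm (A *v d k))\<^sup>2 \<ge> 0" "\<mu> k * (n k)\<^sup>2 \<ge> 0"
      using \<Lambda>_nonneg[of k] \<mu>_pos[of k] by simp_all
    then have "0 \<le> 1/2 * (\<Lambda> k * (norm (A *v d k))\<^sup>2 + \<mu> k * (n k)\<^sup>2)" by simp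
    then have "\<alpha> * \<mu> k / 2 * (n k)\<^sup>2 \<le> pr k" using model_decrease[of k] by argo
    also have "\<dots> \<le> (\<bar>V 0\<bar> + C + K * (1 + E)) + (K * n k + C * n k) + C * (n k)\<^sup>2"
      using 1 2 3 hd_bound[OF k] mult_nonneg_nonneg[OF C zero_le_power2[of "n k"]]
      unfolding pr_def by linarith
    also have "\<dots> \<le> D + D * n k + D * (n k)\<^sup>2"
    proof (intro add_mono)
      show "K * n k + C * n k \<le> D * n k"
        unfolding distrib_right[symmetric] using K(1) C E n_nonneg[of k]
        by (intro mult_right_mono) (simp_all add: D_def)
      show "C * (n k)\<^sup>2 \<le> D * (n k)\<^sup>2"
        using K(1) C E by (intro mult_right_mono) (simp_all add: D_def)
    qed (use K(1) C in \<open>simp add: D_def\<close>)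
    finally show ?thesis by (simp add: algebra_simps)
  qed

  \<comment> \<open>Large regularization forces acceptance\<close>
  have s2: "s / 2 > 0" using s by simp
  obtain M1 where M1: "\<And>\<mu> n. \<lbrakk>\<mu> \<ge> M1; \<alpha> * \<mu> / 2 * n\<^sup>2 \<le> D * (1 + n + n\<^sup>2)\<rbrakk> \<Longrightarrow> n < s / 2"
    using large_mu_short_step[OF parameters(11) s2 D] by blast
  have C2: "2 * C \<ge> 0" using C by simp
  have c1: "c1 < 1" using parameters(2,3) by simp
  obtain M2 where M2:
    "\<And>\<mu> n \<omega> p a. \<lbrakk>\<mu> \<ge> M2; (1 + \<alpha>) / 2 * \<mu> * n\<^sup>2 \<le> p; (1 - \<theta>) * \<omega> \<le> (2 + L + \<mu>) * n;
      \<bar>a - p\<bar> \<le> 2 * C * n\<^sup>2; \<omega> > 0; n \<ge> 0\<rbrakk> \<Longrightarrow> pmin * (1 - \<theta>) * n * \<omega> < p \<and> c1 * p < a"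
    using large_mu_accepts[OF parameters(11) c1 parameters(20,21,10) C2 L] by metis
  \<comment> \<open>Dividing by \<open>\<epsilon> powr \<delta>\<close> turns the thresholds for
    \<open>\<mu>\<close> into one for \<open>\<nu>\<close>, by \<open>\<mu>_ge\<close>.\<close>
  define N where "N = max M1 M2 / \<epsilon> powr \<delta>"
  have large: "\<not> unsuccessful k" if k: "k \<ge> k0" and "\<nu> k \<ge> N" for k
  proof -
    have "max M1 M2 \<le> \<nu> k * \<epsilon> powr \<delta>"
      using \<open>\<nu> k \<ge> N\<close> \<epsilon>(1) by (simp add: N_def pos_divide_le_eq)
    then have \<mu>: "\<mu> k \<ge> M1" "\<mu> k \<ge> M2" using \<mu>_ge[of k] by auto
    have "n k < s / 2" by (rule M1[OF \<mu>(1) growth[OF k]])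
    then have "xhat k \<in> ball xbar s"
      using k0[OF k] dist_triangle[of xbar "xhat k" "x k"]
      by (simp add: n_def step2(1) dist_norm norm_minus_commute)
    from taylor[OF x_ball[OF k] this]
    have "\<bar>fr (xhat k) - fr (x k) - gradient f (x k) \<bullet> d k\<bar> \<le> C * (n k)\<^sup>2"
      by (simp add: n_def step2(1))
    \<comment> \<open>The terms in \<open>\<phi>r\<close> cancel; the Taylor remainder contributes
      \<open>C\<close> and half the Hessian form \<open>C / 2\<close>, rounded up to
      \<open>2 * C\<close>.\<close>
    then have "\<bar>ar k - pr k\<bar> \<le> 2 * C * (n k)\<^sup>2"
      using hd_bound[OF k] unfolding ar_def pr_def Fr_def by linarith
    from M2[OF \<mu>(2) pr_ge step_long[OF k] this \<omega>_pos n_nonneg]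
    show ?thesis using acceptI by blast
  qed

  \<comment> \<open>Contradiction from infinitely many accepted steps\<close>
  have accept: "\<nu> (Suc k) \<le> \<nu>max" if "\<not> unsuccessful k" for k
    using that by (auto simp: step3(2))
  have reject: "\<nu> (Suc k) = \<sigma>2 * \<nu> k" if "unsuccessful k" for k
    using that by (simp add: step3(2))
  obtain B where B: "\<And>k. k \<ge> k0 \<Longrightarrow> \<nu> k \<le> B" "\<And>K. \<exists>k\<ge>K. \<not> unsuccessful k"
    using parameter_bounded_if_accepting[where \<nu>=\<nu> and rejected=unsuccessful, OF parameters(6) \<nu>_pos reject accept large] by metis
  define S where "S = 2 + L + B * rbar 0 powr \<delta>"
  \<comment> \<open>The lower bound on the step obtained from \<open>step_long\<close> when
    \<open>\<mu> k\<close> is at most \<open>B * rbar 0 powr \<delta>\<close> and the residual at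
    least \<open>\<epsilon>\<close>.\<close>
  define n0 where "n0 = (1 - \<theta>) * \<epsilon> / S"
  have "B > 0" using B(1)[of k0] \<nu>_pos[of k0] by simp
  then have S: "S > 0" using L by (simp add: S_def add_pos_nonneg)
  have n0: "n0 > 0" using S \<epsilon>(1) parameters(10) by (simp add: n0_def)
  have n_ge: "n0 \<le> n k" if k: "k \<ge> k0" for k
  proof -
    have "\<mu> k \<le> B * rbar 0 powr \<delta>"
      using \<mu>_le[of k] mult_right_mono[OF B(1)[OF k], of "rbar 0 powr \<delta>"] by simp
    then have "(2 + L + \<mu> k) * n k \<le> S * n k"
      unfolding S_def using n_nonneg[of k] by (intro mult_right_mono) auto
    moreover have "(1 - \<theta>) * \<epsilon> \<le> (1 - \<theta>) * \<omega> k"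
      using \<epsilon>(2)[of k] parameters(10) by (intro mult_left_mono) auto
    ultimately have "(1 - \<theta>) * \<epsilon> \<le> S * n k" using step_long[OF k] by linarith
    then show ?thesis using S by (simp add: n0_def pos_divide_le_eq mult.commute)
  qed
  obtain l where l: "V \<longlonglongrightarrow> l" using V_conv by (auto simp: convergent_def)
  \<comment> \<open>Convergence of \<open>V\<close> forces its decreases to 0, whereas every late
    accepted step decreases it by at least \<open>c * n0\<close>.\<close>
  have "(\<lambda>k. V k - V (Suc k)) \<longlonglongrightarrow> l - l"
    by (intro tendsto_diff l LIMSEQ_Suc)
  then have "eventually (\<lambda>k. V k - V (Suc k) < c * n0) sequentially"
    using c n0 by (intro order_tendstoD) auto
  then obtain k1 where k1: "\<And>k. k \<ge> k1 \<Longrightarrow> V k - V (Suc k) < c * n0"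
    by (auto simp: eventually_sequentially)
  obtain k where k: "k \<ge> max k0 k1" "\<not> unsuccessful k" using B(2) by blast
  have "c * n0 \<le> c * n k" using n_ge[of k] k(1) c by simp
  also have "\<dots> \<le> V k - V (Suc k)"
    using acceptD[OF k(2)] k(2) by (simp add: V_def ar_def step3(1))
  finally show False using k1[of k] k(1) by simp
qed

end
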